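(* Let $(X,\mu,T)$ be a measure-preserving $G$-system, where $G$ is the free group of rank $r$. For any finite observable $\beta\colon X\to B$ and any sequence $\{m_n\in\mathbb N\}_{n=1}^\infty$ approaching infinity while satisfying $m_n=o(\log\log n)$, there exist sequences $\{\mathbf y_n\in B^n\}_{n=1}^\infty$ and $\{\sigma_n\in\mathrm{Hom}(G,\mathrm{Sym}(n))\}_{n=1}^\infty$ such that $$d_{m_n}^*\big(P^{\sigma_n}_{\mathbf y_n},\beta^G_*\mu\big)=O\big(\tfrac{1}{\log n}\big)\quad\text{as } n\to\infty.$$
   Context: $G$ is the free group of rank $r\ge1$ with free generators $s_1,\dots,s_r$, identity $e$ and word length $|\cdot|$; $B(g,k)=\{hg: h\in G,\ |h|\le k\}$ is the closed ball of radius $k$ about $g$. $(X,\mu)$ is a standard probability space and $T$ is a homomorphism from $G$ to its group of measure-preserving automorphisms. A finite observable is a measurable map $\beta\colon X\to B$ to a finite set $B$; $\beta^G\colon X\to B^G$ is $(\beta^G(x))_g=\beta(T_gx)$. For $\sigma\in\mathrm{Hom}(G,\mathrm{Sym}(n))$ and $\mathbf y\in B^n$, define $\mathbf y^G\colon[n]\to B^G$ by $(\mathbf y^G(j))_g=\mathbf y(\sigma(g)j)$, and $P^\sigma_{\mathbf y}=(\mathbf y^G)_*\mathrm{Unif}(n)\in\mathrm{Prob}(B^G)$. For finite $H\subset G$, $d^H(\nu,\nu')$ is the total variation distance ($\frac12$ of the $\ell^1$ distance) between the marginals of $\nu,\nu'\in\mathrm{Prob}(B^G)$ on $B^H$, and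 $d_k^*(\nu,\nu')=\sum_{i=1}^rd^{B(e,k)\cup B(s_i,k)}(\nu,\nu')$. *)

theory Defs
  imports
    "HOL-Algebra.Bij"
    "HOL-Algebra.Sym_Groups"
    "HOL-Probability.Probability_Measure"
    "HOL-Library.Landau_Symbols"
begin

section \<open>The free group of rank \<open>r\<close>\<close>

text \<open>
  The letter \<open>(i, True)\<close> stands for the generator \<open>s\<^sub>i\<close> and \<open>(i, False)\<close> for its inverse, where
  \<open>i \<in> {1..r}\<close>. The elements of the free group are the reduced words; multiplication is
  concatenation followed by reduction.
\<close>

type_synonym letter = "nat \<times> bool"
type_synonym word = "letter list"

definition inv_letter :: "letter \<Rightarrow> letter" where
  "inv_letter a = (fst a, \<not> snd a)"

definition reduced_word :: "word \<Rightarrow> bool" where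
  "reduced_word w \<longleftrightarrow> successively (\<lambda>a b. b \<noteq> inv_letter a) w"

fun letter_mult :: "letter \<Rightarrow> word \<Rightarrow> word" where
  "letter_mult a [] = [a]"
| "letter_mult a (b # w) = (if b = inv_letter a then w else a # b # w)"

definition word_mult :: "word \<Rightarrow> word \<Rightarrow> word" where
  "word_mult u v = foldr letter_mult u v"

definition free_group :: "nat \<Rightarrow> word monoid" where
  "free_group r =
    \<lparr>carrier = {w. reduced_word w \<and> fst ` set w \<subseteq> {1..r}}, monoid.mult = word_mult, one = []\<rparr>"

definition gen :: "nat \<Rightarrow> word" where
  "gen i = [(i, True)]"

text \<open>The word length of a reduced word is its length as a list.\<close>

definition free_ball :: "nat \<Rightarrow> word \<Rightarrow> nat \<Rightarrow> word set" where
  "free_ball r g k =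
    {h \<otimes>\<^bsub>free_group r\<^esub> g | h. h \<in> carrier (free_group r) \<and> length h \<le> k}"

text \<open>That this is the free group on \<open>s\<^sub>1, \<dots>, s\<^sub>r\<close>:\<close>

lemma inv_letter_inv_letter [simp]: "inv_letter (inv_letter a) = a"
  by (simp add: inv_letter_def)

lemma fst_inv_letter [simp]: "fst (inv_letter a) = fst a"
  by (simp add: inv_letter_def)

lemma reduced_Nil [simp]: "reduced_word []"
  by (simp add: reduced_word_def)

lemma reduced_Cons: "reduced_word (a # w) \<longleftrightarrow> reduced_word w \<and> (w = [] \<or> hd w \<noteq> inv_letter a)"
  by (auto simp: reduced_word_def successively_Cons)

lemma reduced_letter_mult: "reduced_word w \<Longrightarrow> reduced_word (letter_mult a w)"
  by (cases w) (auto simp: reduced_Cons)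

lemma letter_mult_inv:
  assumes "reduced_word w"
  shows "letter_mult (inv_letter a) (letter_mult a w) = w"
proof (cases w)
  case (Cons b v)
  then show ?thesis using assms by (cases v) (auto simp: reduced_Cons)
qed simp

lemma letter_mult_inv':
  "reduced_word w \<Longrightarrow> letter_mult a (letter_mult (inv_letter a) w) = w"
  using letter_mult_inv[of w "inv_letter a"] by simp

lemma word_mult_simps [simp]:
  "word_mult [] v = v"
  "word_mult (a # u) v = letter_mult a (word_mult u v)"
  by (simp_all add: word_mult_def)

lemma word_mult_append: "word_mult (u @ v) w = word_mult u (word_mult v w)"
  by (simp add: word_mult_def)

lemma reduced_word_mult: "reduced_word v \<Longrightarrow> reduced_word (word_mult u v)"
  by (induction u) (auto intro: reduced_letter_mult)

lemma word_mult_Nil: "reduced_word u \<Longrightarrow> word_mult u [] = u"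
proof (induction u)
  case (Cons a u)
  then show ?case by (cases u) (auto simp: reduced_Cons)
qed simp

lemma word_mult_letter_mult:
  assumes "reduced_word u" "reduced_word w"
  shows "word_mult (letter_mult a u) w = letter_mult a (word_mult u w)"
  using assms by (cases u) (auto simp: letter_mult_inv' reduced_word_mult)

lemma word_mult_assoc:
  assumes "reduced_word v" "reduced_word w"
  shows "word_mult (word_mult u v) w = word_mult u (word_mult v w)"
  using assms by (induction u) (simp_all add: word_mult_letter_mult reduced_word_mult)

lemma letters_letter_mult: "fst ` set (letter_mult a w) \<subseteq> insert (fst a) (fst ` set w)"
  by (cases w) auto

lemma letters_word_mult: "fst ` set (word_mult u v) \<subseteq> fst ` set u \<union> fst ` set v"
proof (induction u)
  case (Cons a u)
  have "fst ` set (word_mult (a # u) v) \<subseteq> insert (fst a) (fst ` set (word_mult u v))"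
    by (simp add: letters_letter_mult)
  also have "\<dots> \<subseteq> insert (fst a) (fst ` set u \<union> fst ` set v)"
    using Cons.IH by (rule insert_mono)
  finally show ?case by simp
qed simp

lemma reduced_inverse_word: "reduced_word w \<Longrightarrow> reduced_word (rev (map inv_letter w))"
  by (auto simp: reduced_word_def successively_map elim!: successively_mono)

lemma word_mult_inverse_word:
  "reduced_word w \<Longrightarrow> word_mult (rev (map inv_letter u)) (word_mult u w) = w"
  by (induction u) (simp_all add: word_mult_append letter_mult_inv reduced_word_mult)

lemma group_free_group: "group (free_group r)"
proof (rule groupI)
  fix x y assume "x \<in> carrier (free_group r)" "y \<in> carrier (free_group r)"
  then show "x \<otimes>\<^bsub>free_group r\<^esub> y \<in> carrier (free_group r)"
    using order_trans[OF letters_word_mult[of x y], of "{1..r}"]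
    by (simp add: free_group_def reduced_word_mult)
next
  fix x assume x: "x \<in> carrier (free_group r)"
  show "\<exists>y\<in>carrier (free_group r). y \<otimes>\<^bsub>free_group r\<^esub> x = \<one>\<^bsub>free_group r\<^esub>"
  proof
    show "rev (map inv_letter x) \<in> carrier (free_group r)"
      using x reduced_inverse_word[of x] by (auto simp: free_group_def image_image)
    show "rev (map inv_letter x) \<otimes>\<^bsub>free_group r\<^esub> x = \<one>\<^bsub>free_group r\<^esub>"
      using x word_mult_inverse_word[of "[]" x]
      by (simp add: free_group_def word_mult_Nil)
  qed
qed (auto simp: free_group_def word_mult_assoc)

lemma gen_in_free_group: "i \<in> {1..r} \<Longrightarrow> gen i \<in> carrier (free_group r)"
  by (simp add: gen_def free_group_def reduced_word_def)

lemma (in group) free_group_universal: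
  assumes f: "\<And>i. i \<in> {1..r} \<Longrightarrow> f i \<in> carrier G"
  shows "\<exists>!\<phi>. \<phi> \<in> hom (free_group r) G \<inter> extensional (carrier (free_group r)) \<and>
    (\<forall>i\<in>{1..r}. \<phi> (gen i) = f i)"
proof -
  let ?F = "free_group r"
  define ev where "ev a = (if snd a then f (fst a) else inv (f (fst a)))" for a :: letter
  define \<psi> where "\<psi> w = foldr (\<lambda>a g. ev a \<otimes> g) w \<one>" for w
  have [simp]: "\<psi> [] = \<one>" "\<psi> (a # w) = ev a \<otimes> \<psi> w" for a w
    by (simp_all add: \<psi>_def)
  have ev: "ev a \<in> carrier G" if "fst a \<in> {1..r}" for a
    using that f by (auto simp: ev_def)
  have ev_inv: "ev a \<otimes> ev (inv_letter a) = \<one>" if "fst a \<in> {1..r}" for a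
    using f[OF that] by (auto simp: ev_def inv_letter_def)
  have psi: "\<psi> w \<in> carrier G" if "fst ` set w \<subseteq> {1..r}" for w
    using that by (induction w) (auto intro!: m_closed ev simp del: atLeastAtMost_iff)
  have psi_letter: "\<psi> (letter_mult a w) = ev a \<otimes> \<psi> w"
    if "fst a \<in> {1..r}" "fst ` set w \<subseteq> {1..r}" for a w
  proof (cases w)
    case (Cons b v)
    show ?thesis
    proof (cases "b = inv_letter a")
      case True
      have "ev a \<otimes> (ev (inv_letter a) \<otimes> \<psi> v) = (ev a \<otimes> ev (inv_letter a)) \<otimes> \<psi> v"
        using that Cons by (intro m_assoc[symmetric] ev psi) auto
      moreover have "\<psi> v \<in> carrier G" using that Cons by (intro psi) auto
      ultimately show ?thesis using True Cons ev_inv[OF that(1)] by simp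
    qed (simp add: Cons)
  qed simp
  have psi_mult: "\<psi> (word_mult u v) = \<psi> u \<otimes> \<psi> v"
    if "fst ` set u \<subseteq> {1..r}" "fst ` set v \<subseteq> {1..r}" for u v
    using that(1)
  proof (induction u)
    case Nil
    then show ?case using psi[OF that(2)] by simp
  next
    case (Cons a u)
    have "fst ` set (word_mult u v) \<subseteq> {1..r}"
      using order_trans[OF letters_word_mult[of u v], of "{1..r}"] Cons.prems that(2) by simp
    then have "\<psi> (word_mult (a # u) v) = ev a \<otimes> (\<psi> u \<otimes> \<psi> v)"
      using Cons psi_letter[of a "word_mult u v"] by simp
    also have "\<dots> = \<psi> (a # u) \<otimes> \<psi> v"
      using Cons.prems that(2) ev[of a] psi[of u] psi[of v] by (simp add: m_assoc)
    finally show ?case .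
  qed
  show ?thesis
  proof (rule ex1I[of _ "restrict \<psi> (carrier ?F)"])
    have "restrict \<psi> (carrier ?F) \<in> hom ?F G"
    proof (rule homI)
      fix x assume "x \<in> carrier ?F"
      then show "restrict \<psi> (carrier ?F) x \<in> carrier G"
        using psi[of x] by (simp add: free_group_def)
    next
      fix x y assume xy: "x \<in> carrier ?F" "y \<in> carrier ?F"
      then have "x \<otimes>\<^bsub>?F\<^esub> y \<in> carrier ?F"
        using group.is_monoid[OF group_free_group] by (simp add: monoid.m_closed)
      then show "restrict \<psi> (carrier ?F) (x \<otimes>\<^bsub>?F\<^esub> y)
          = restrict \<psi> (carrier ?F) x \<otimes> restrict \<psi> (carrier ?F) y"
        using xy psi_mult[of x y] by (simp add: free_group_def)
    qed
    moreover have "restrict \<psi> (carrier ?F) (gen i) = f i" if "i \<in> {1..r}" for i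
      using gen_in_free_group[OF that] f[OF that] by (simp add: gen_def ev_def)
    ultimately show "restrict \<psi> (carrier ?F) \<in> hom ?F G \<inter> extensional (carrier ?F) \<and>
        (\<forall>i\<in>{1..r}. restrict \<psi> (carrier ?F) (gen i) = f i)"
      by auto
  next
    fix \<phi> assume \<phi>: "\<phi> \<in> hom ?F G \<inter> extensional (carrier ?F) \<and>
        (\<forall>i\<in>{1..r}. \<phi> (gen i) = f i)"
    interpret \<phi>: group_hom ?F G \<phi>
      using \<phi> group_free_group is_group by (auto simp: group_hom_def group_hom_axioms_def)
    have letter: "\<phi> [a] = ev a" if a: "fst a \<in> {1..r}" for a
    proof (cases "snd a")
      case True
      then have "[a] = gen (fst a)" by (cases a) (simp add: gen_def)
      then show ?thesis using True \<phi> a by (simp add: ev_def)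
    next
      case False
      have c: "[a] \<in> carrier ?F" "gen (fst a) \<in> carrier ?F"
        using a gen_in_free_group by (auto simp: free_group_def reduced_word_def)
      have "[a] \<otimes>\<^bsub>?F\<^esub> gen (fst a) = \<one>\<^bsub>?F\<^esub>"
        using False by (cases a) (simp add: free_group_def gen_def inv_letter_def)
      then have "\<phi> [a] \<otimes> \<phi> (gen (fst a)) = \<one>"
        using c by (metis \<phi>.hom_mult \<phi>.hom_one)
      then show ?thesis
        using False \<phi> a c f[OF a] inv_equality[of "\<phi> [a]" "f (fst a)"] \<phi>.hom_closed[of "[a]"]
        by (simp add: ev_def)
    qed
    have eq: "\<phi> w = \<psi> w" if "w \<in> carrier ?F" for w
      using that
    proof (induction w)
      case Nil
      then show ?case using \<phi>.hom_one by (simp add: free_group_def)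
    next
      case (Cons a w)
      then have c: "[a] \<in> carrier ?F" "w \<in> carrier ?F" "fst a \<in> {1..r}"
        by (auto simp: free_group_def reduced_Cons)
      have "[a] \<otimes>\<^bsub>?F\<^esub> w = a # w"
        using Cons.prems by (cases w) (auto simp: free_group_def reduced_Cons)
      then show ?case using c Cons.IH letter[of a] \<phi>.hom_mult[of "[a]" w] by simp
    qed
    show "\<phi> = restrict \<psi> (carrier ?F)"
      using \<phi> eq by (intro extensionalityI[of _ "carrier ?F"]) auto
  qed
qed

section \<open>Measure-preserving systems\<close>

definition standard_borel :: "'a measure \<Rightarrow> bool" where
  "standard_borel M \<longleftrightarrow>
    (\<exists>\<tau>. topspace \<tau> = space M \<and> completely_metrizable_space \<tau> \<and> second_countable \<tau> \<and>
         sets M = sigma_sets (space M) {U. openin \<tau> U})"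

text \<open>
  Both usual conventions are admitted: a Borel probability measure on a standard Borel space,
  and the completion of one.
\<close>

definition standard_prob_space :: "'a measure \<Rightarrow> bool" where
  "standard_prob_space M \<longleftrightarrow> prob_space M \<and>
    (standard_borel M \<or> (\<exists>N. standard_borel N \<and> M = completion N))"

definition mp_automorphisms :: "'a measure \<Rightarrow> ('a \<Rightarrow> 'a) set" where
  "mp_automorphisms M = {f \<in> Bij (space M).
     f \<in> measurable M M \<and> inv_into (space M) f \<in> measurable M M \<and> distr M M f = M}"

definition mp_aut_group :: "'a measure \<Rightarrow> ('a \<Rightarrow> 'a) monoid" where
  "mp_aut_group M = BijGroup (space M) \<lparr>carrier := mp_automorphisms M\<rparr>"

definition mp_system :: "nat \<Rightarrow> 'a measure \<Rightarrow> (word \<Rightarrow> 'a \<Rightarrow> 'a) \<Rightarrow> bool" where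
  "mp_system r M T \<longleftrightarrow> standard_prob_space M \<and> T \<in> hom (free_group r) (mp_aut_group M)"

section \<open>Empirical distributions and the distances \<open>d\<^sub>k\<^sup>*\<close>\<close>

text \<open>\<open>B\<^sup>H\<close> with the product \<open>\<sigma>\<close>-algebra, \<open>B\<close> being discrete.\<close>

definition config_space :: "word set \<Rightarrow> 'b set \<Rightarrow> (word \<Rightarrow> 'b) measure" where
  "config_space H B = PiM H (\<lambda>_. count_space B)"

definition itinerary :: "nat \<Rightarrow> (word \<Rightarrow> 'a \<Rightarrow> 'a) \<Rightarrow> ('a \<Rightarrow> 'b) \<Rightarrow> 'a \<Rightarrow> word \<Rightarrow> 'b" where
  "itinerary r T \<beta> x = (\<lambda>g\<in>carrier (free_group r). \<beta> (T g x))"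

definition itinerary_distr ::
    "nat \<Rightarrow> 'b set \<Rightarrow> 'a measure \<Rightarrow> (word \<Rightarrow> 'a \<Rightarrow> 'a) \<Rightarrow> ('a \<Rightarrow> 'b) \<Rightarrow> (word \<Rightarrow> 'b) measure" where
  "itinerary_distr r B M T \<beta> =
    distr M (config_space (carrier (free_group r)) B) (itinerary r T \<beta>)"

definition empirical_distr ::
    "nat \<Rightarrow> 'b set \<Rightarrow> nat \<Rightarrow> (word \<Rightarrow> nat \<Rightarrow> nat) \<Rightarrow> (nat \<Rightarrow> 'b) \<Rightarrow> (word \<Rightarrow> 'b) measure" where
  "empirical_distr r B n \<sigma> y = itinerary_distr r B (uniform_count_measure {1..n}) \<sigma> y"

definition marginal :: "word set \<Rightarrow> 'b set \<Rightarrow> (word \<Rightarrow> 'b) measure \<Rightarrow> (word \<Rightarrow> 'b) measure" where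
  "marginal H B \<nu> = distr \<nu> (config_space H B) (\<lambda>\<omega>. restrict \<omega> H)"

definition tv_dist ::
    "word set \<Rightarrow> 'b set \<Rightarrow> (word \<Rightarrow> 'b) measure \<Rightarrow> (word \<Rightarrow> 'b) measure \<Rightarrow> real" where
  "tv_dist H B \<nu> \<nu>' =
    (\<Sum>a\<in>(H \<rightarrow>\<^sub>E B). \<bar>measure (marginal H B \<nu>) {a} - measure (marginal H B \<nu>') {a}\<bar>) / 2"

definition d_star ::
    "nat \<Rightarrow> 'b set \<Rightarrow> nat \<Rightarrow> (word \<Rightarrow> 'b) measure \<Rightarrow> (word \<Rightarrow> 'b) measure \<Rightarrow> real" where
  "d_star r B k \<nu> \<nu>' = (\<Sum>i=1..r.
     tv_dist (free_ball r \<one>\<^bsub>free_group r\<^esub> k \<union> free_ball r (gen i) k) B \<nu> \<nu>')"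

end

theory Submission
  imports Defs "HOL-Real_Asymp.Real_Asymp"
begin

text \<open>
  The proof rounds the distribution of the patterns of the system and builds a finite action on
  \<open>n\<close> points from the result. Give the points of \<open>{1..n}\<close> labels that are patterns on the ball
  \<open>B(e, k)\<close>, each pattern about as often as its probability requires. For each generator \<open>s\<^sub>i\<close>, a
  pattern \<open>z\<close> on the window \<open>B(e, k) \<union> B(s\<^sub>i, k)\<close> prescribes an edge from its restriction to
  \<open>B(e, k)\<close>, the pattern seen at \<open>x\<close>, to its restriction to \<open>B(s\<^sub>i, k)\<close>, the pattern seen at
  \<open>T\<^bsub>s\<^sub>i\<^esub> x\<close>. Take \<open>n\<close> times the probability of \<open>z\<close>, rounded down, copies of that edge. Rounding
  down and the invariance of the measure guarantee that the edges can be placed on the vertices with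
  matching labels as a partial injection (\<open>edges_realisable\<close>); any extension to a permutation will
  do. As the group is free, the \<open>r\<close> permutations define an action, and the observable at a point is
  the entry at the identity of its label.

  For each generator, only the edges lost to rounding can be wrong, fewer than one for each window
  pattern. Whenever a point has only correct steps within distance \<open>k\<close>, the overlaps of consecutive
  labels show that its label is the pattern that the action really produces; so each wrong edge spoils
  at most about \<open>(2r+1)\<^sup>k\<close> points (\<open>labels_are_patterns\<close>). This is why the lost edges may be replaced
  arbitrarily. The distance is then at most \<open>2 r (2r+1)\<^sup>k |B|\<^bsup>2(2r+1)\<^sup>k\<^esup> / n\<close> for every \<open>n \<ge> 1\<close> and
  every \<open>k\<close> (\<open>finite_model\<close>).

  For \<open>k = m\<^sub>n = o(log log n)\<close> the ball sizes \<open>(2r+1)\<^sup>k\<close> stay below \<open>sqrt (log n)\<close>, so the number of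
  patterns is \<open>n\<close> to a power tending to \<open>0\<close> and the bound is far smaller than \<open>1 / log n\<close>
  (\<open>pattern_count_negligible\<close>).
\<close>

section \<open>Matchings with prescribed endpoints\<close>

lemma fibrewise_injection:
  assumes "finite E" "finite V" "\<And>a. card {e\<in>E. f e = a} \<le> card {v\<in>V. g v = a}"
  shows "\<exists>p. inj_on p E \<and> p ` E \<subseteq> V \<and> (\<forall>e\<in>E. g (p e) = f e)"
proof -
  have "\<forall>a. \<exists>h. h ` {e\<in>E. f e = a} \<subseteq> {v\<in>V. g v = a} \<and> inj_on h {e\<in>E. f e = a}"
    using assms by (intro allI card_le_inj) simp_all
  from choice[OF this] obtain h where h: "\<And>a. h a ` {e\<in>E. f e = a} \<subseteq> {v\<in>V. g v = a}"
      "\<And>a. inj_on (h a) {e\<in>E. f e = a}"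
    by blast
  have hE: "h (f e) e \<in> V \<and> g (h (f e) e) = f e" if "e \<in> E" for e
    using h(1)[of "f e"] that by auto
  have "inj_on (\<lambda>e. h (f e) e) E"
  proof (rule inj_onI)
    fix e e' assume e: "e \<in> E" "e' \<in> E" "h (f e) e = h (f e') e'"
    then have "f e = f e'" using hE by metis
    then show "e = e'" using e inj_onD[OF h(2)[of "f e"], of e e'] by simp
  qed
  then show ?thesis using hE by (intro exI[of _ "\<lambda>e. h (f e) e"]) blast
qed

text \<open>
  Reading an edge \<open>e\<close> as an arrow from \<open>p e\<close> to \<open>q e\<close>, the arrows form a partial injection of \<open>V\<close>;
  the points without an outgoing arrow and those without an incoming one are equally many, so they
  can be matched arbitrarily.
\<close>

lemma matching_extends_to_permutation:
  assumes "finite V" "inj_on p E" "inj_on q E" "p ` E \<subseteq> V" "q ` E \<subseteq> V"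
  shows "\<exists>\<pi>. \<pi> permutes V \<and> (\<forall>e\<in>E. \<pi> (p e) = q e)"
proof -
  have "finite (p ` E)" "finite (q ` E)" using assms(1,4,5) by (simp_all add: finite_subset[of _ V])
  then have "card (V - p ` E) = card (V - q ` E)"
    using assms by (simp add: card_Diff_subset card_image)
  then obtain h where h: "bij_betw h (V - p ` E) (V - q ` E)"
    using assms(1) finite_same_card_bij[of "V - p ` E" "V - q ` E"] by auto
  define \<pi> where "\<pi> v = (if v \<in> p ` E then q (inv_into E p v) else if v \<in> V then h v else v)" for v
  have "bij_betw \<pi> (p ` E) (q ` E)"
  proof -
    have "bij_betw (q \<circ> inv_into E p) (p ` E) (q ` E)"
      by (rule bij_betw_trans[OF bij_betw_inv_into[OF inj_on_imp_bij_betw] inj_on_imp_bij_betw])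
        (rule assms)+
    then show ?thesis by (rule iffD1[OF bij_betw_cong, rotated]) (simp add: \<pi>_def)
  qed
  moreover have "bij_betw \<pi> (V - p ` E) (V - q ` E)"
    using h by (rule iffD1[OF bij_betw_cong, rotated]) (simp add: \<pi>_def)
  ultimately have "bij_betw \<pi> (p ` E \<union> (V - p ` E)) (q ` E \<union> (V - q ` E))"
    by (rule bij_betw_combine) auto
  then have "bij_betw \<pi> V V" using assms by (simp add: Un_absorb1)
  moreover have "\<pi> v = v" if "v \<notin> V" for v
    using that assms by (auto simp: \<pi>_def)
  ultimately have "\<pi> permutes V" by (rule bij_imp_permutes)
  moreover have "\<forall>e\<in>E. \<pi> (p e) = q e" using assms by (simp add: \<pi>_def)
  ultimately show ?thesis by blast
qed

lemma labelling_with_multiplicities: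
  assumes "finite V" "finite A" "a0 \<in> A" "(\<Sum>a\<in>A. w a) \<le> card V"
  shows "\<exists>l. (\<forall>v\<in>V. l v \<in> A) \<and> (\<forall>a\<in>A. w a \<le> card {v\<in>V. l v = a})"
proof -
  define E where "E = (SIGMA a:A. {..<w a})"
  have fE: "finite E" using assms by (simp add: E_def)
  have "card E = (\<Sum>a\<in>A. w a)" using assms by (simp add: E_def)
  then obtain p where p: "p ` E \<subseteq> V" "inj_on p E"
    using card_le_inj[of E V] fE assms by auto
  define l where "l v = (if v \<in> p ` E then fst (inv_into E p v) else a0)" for v
  have "l v \<in> A" for v
  proof (cases "v \<in> p ` E")
    case True
    then show ?thesis using inv_into_into[OF True] by (auto simp: l_def E_def)
  qed (simp add: l_def assms)
  moreover have "w a \<le> card {v\<in>V. l v = a}" if "a \<in> A" for a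
  proof -
    have "w a = card ({a} \<times> {..<w a})" by simp
    also have "\<dots> \<le> card {v\<in>V. l v = a}"
    proof (rule card_inj_on_le[of p])
      show "inj_on p ({a} \<times> {..<w a})"
        using p(2) by (rule inj_on_subset) (use that in \<open>auto simp: E_def\<close>)
      show "p ` ({a} \<times> {..<w a}) \<subseteq> {v\<in>V. l v = a}"
        proof clarsimp
          fix t assume "t < w a"
          then have "(a, t) \<in> E" using that by (simp add: E_def)
          then show "p (a, t) \<in> V \<and> l (p (a, t)) = a" using p by (auto simp: l_def)
        qed
    qed (use assms in auto)
    finally show ?thesis .
  qed
  ultimately show ?thesis by blast
qed

section \<open>Words and balls\<close>

lemma in_carrier_free_group:
  "w \<in> carrier (free_group r) \<longleftrightarrow> reduced_word w \<and> fst ` set w \<subseteq> {1..r}"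
  by (simp add: free_group_def)

lemma mult_free_group [simp]: "u \<otimes>\<^bsub>free_group r\<^esub> v = word_mult u v"
  by (simp add: free_group_def)

lemma one_free_group [simp]: "\<one>\<^bsub>free_group r\<^esub> = []"
  by (simp add: free_group_def)

lemma Nil_in_carrier [simp]: "[] \<in> carrier (free_group r)"
  by (simp add: in_carrier_free_group)

lemma word_mult_in_carrier:
  "g \<in> carrier (free_group r) \<Longrightarrow> h \<in> carrier (free_group r) \<Longrightarrow>
    word_mult g h \<in> carrier (free_group r)"
  using monoid.m_closed[OF group.is_monoid[OF group_free_group], of g r h] by simp

lemma word_mult_reduced_append: "reduced_word (u @ v) \<Longrightarrow> word_mult u v = u @ v"
proof (induction u)
  case (Cons a u)
  then show ?case by (cases "u @ v") (auto simp: reduced_Cons)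
qed simp

lemma free_ball_one: "free_ball r [] k = {w \<in> carrier (free_group r). length w \<le> k}"
proof -
  have "free_ball r [] k = (\<lambda>h. word_mult h []) ` {w \<in> carrier (free_group r). length w \<le> k}"
    by (auto simp: free_ball_def)
  also have "\<dots> = (\<lambda>h. h) ` {w \<in> carrier (free_group r). length w \<le> k}"
    by (rule image_cong) (auto simp: in_carrier_free_group word_mult_Nil)
  finally show ?thesis by simp
qed

lemma free_ball_translate: "free_ball r g k = (\<lambda>h. word_mult h g) ` free_ball r [] k"
  unfolding free_ball_one by (auto simp: free_ball_def)

text \<open>
  The base \<open>2 * r + 1\<close>, cruder than the true growth rate \<open>2 * r - 1\<close>, is the one that also
  bounds the growth of the exceptional set in \<open>labels_are_patterns\<close>.
\<close>

lemma free_ball_bound: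
  "finite (free_ball r [] k) \<and> card (free_ball r [] k) \<le> (2 * r + 1) ^ k"
proof -
  define S :: "letter set" where "S = {1..r} \<times> UNIV"
  have S: "finite S" "card S = 2 * r" by (simp_all add: S_def)
  have sub: "free_ball r [] k \<subseteq> {w. set w \<subseteq> S \<and> length w \<le> k}"
    by (auto simp: free_ball_one in_carrier_free_group S_def)
  have "(\<Sum>i\<le>k. (2 * r) ^ i) \<le> (2 * r + 1) ^ k"
  proof (induction k)
    case (Suc k)
    have "(\<Sum>i\<le>Suc k. (2 * r) ^ i) \<le> (2 * r + 1) ^ k + 2 * r * (2 * r) ^ k" using Suc by simp
    also have "\<dots> \<le> (2 * r + 1) ^ k + 2 * r * (2 * r + 1) ^ k"
      by (intro add_left_mono mult_left_mono power_mono) auto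
    finally show ?case by (simp add: algebra_simps)
  qed simp
  then show ?thesis
    using card_lists_length_le[OF S(1), of k] finite_lists_length_le[OF S(1), of k]
      card_mono[OF _ sub] finite_subset[OF sub] S(2) by simp
qed

section \<open>Patterns and their frequencies\<close>

definition pattern :: "(word \<Rightarrow> 'a \<Rightarrow> 'a) \<Rightarrow> ('a \<Rightarrow> 'b) \<Rightarrow> word set \<Rightarrow> 'a \<Rightarrow> word \<Rightarrow> 'b" where
  "pattern T \<beta> H x = (\<lambda>g\<in>H. \<beta> (T g x))"

text \<open>
  Since \<open>T\<^bsub>hg\<^esub> = T\<^bsub>h\<^esub> T\<^bsub>g\<^esub>\<close>, the pattern of \<open>x\<close> on \<open>B(s\<^sub>i, k)\<close> is the pattern of \<open>T\<^bsub>s\<^sub>i\<^esub> x\<close> on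
  \<open>B(e, k)\<close>. So a pattern on the window records what is seen from both ends of an \<open>s\<^sub>i\<close>-edge.
\<close>

definition window :: "nat \<Rightarrow> nat \<Rightarrow> nat \<Rightarrow> word set" where
  "window r k i = free_ball r [] k \<union> free_ball r (gen i) k"

lemma window_carrier: "i \<in> {1..r} \<Longrightarrow> window r k i \<subseteq> carrier (free_group r)"
  using gen_in_free_group[of i r] by (auto simp: window_def free_ball_def intro!: word_mult_in_carrier)

lemma window_bound: "finite (window r k i) \<and> card (window r k i) \<le> 2 * (2 * r + 1) ^ k"
proof -
  have "card (window r k i) \<le> card (free_ball r [] k) + card (free_ball r (gen i) k)"
    unfolding window_def by (rule card_Un_le)
  moreover have "card (free_ball r (gen i) k) \<le> card (free_ball r [] k)"
    unfolding free_ball_translate[of r "gen i"] using free_ball_bound by (intro card_image_le) simp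
  ultimately show ?thesis
    using free_ball_bound[of r k] by (simp add: window_def free_ball_translate[of r "gen i"])
qed

text \<open>
  The measure-preserving system and its finite model are treated alike: the model is an instance of
  this locale with the uniform measure on \<open>{1..n}\<close>, and both marginals are read off from pattern
  frequencies.
\<close>
locale observed_process =
  fixes r :: nat and M :: "'a measure" and T :: "word \<Rightarrow> 'a \<Rightarrow> 'a"
    and B :: "'b set" and \<beta> :: "'a \<Rightarrow> 'b"
  assumes prob_M: "prob_space M" and finite_B: "finite B"
    and step_measurable:
      "g \<in> carrier (free_group r) \<Longrightarrow> (\<lambda>x. \<beta> (T g x)) \<in> measurable M (count_space B)"
begin

lemma pattern_in_PiE:
  "H \<subseteq> carrier (free_group r) \<Longrightarrow> x \<in> space M \<Longrightarrow> pattern T \<beta> H x \<in> H \<rightarrow>\<^sub>E B"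
  using measurable_space[OF step_measurable, of _ x] by (auto simp: pattern_def)

definition freq :: "word set \<Rightarrow> (word \<Rightarrow> 'b) \<Rightarrow> real" where
  "freq H z = measure M {x \<in> space M. pattern T \<beta> H x = z}"

lemma pattern_fibre_sets:
  assumes "finite H" "H \<subseteq> carrier (free_group r)"
  shows "{x \<in> space M. pattern T \<beta> H x = z} \<in> sets M"
proof (cases "z \<in> H \<rightarrow>\<^sub>E B")
  case True
  have "{x \<in> space M. pattern T \<beta> H x = z} = {x \<in> space M. \<forall>g\<in>H. \<beta> (T g x) = z g}"
    using True by (auto simp: pattern_def fun_eq_iff PiE_iff extensional_def)
  also have "\<dots> \<in> sets M"
  proof (rule sets.sets_Collect_finite_All)
    fix g assume g: "g \<in> H"
    have "{x \<in> space M. \<beta> (T g x) = z g} = (\<lambda>x. \<beta> (T g x)) -` {z g} \<inter> space M" by auto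
    also have "\<dots> \<in> sets M"
      using True g assms by (intro measurable_sets[OF step_measurable]) auto
    finally show "{x \<in> space M. \<beta> (T g x) = z g} \<in> sets M" .
  qed (rule assms)
  finally show ?thesis .
next
  case False
  then have "{x \<in> space M. pattern T \<beta> H x = z} = {}" using pattern_in_PiE[OF assms(2)] by auto
  then show ?thesis by (simp only: sets.empty_sets)
qed

lemma prob_pattern_event:
  assumes "finite H" "H \<subseteq> carrier (free_group r)"
  shows "measure M {x \<in> space M. P (pattern T \<beta> H x)} = (\<Sum>z | z \<in> H \<rightarrow>\<^sub>E B \<and> P z. freq H z)"
proof -
  interpret prob_space M by (rule prob_M)
  have "{x \<in> space M. P (pattern T \<beta> H x)}
      = (\<Union>z\<in>{z \<in> H \<rightarrow>\<^sub>E B. P z}. {x \<in> space M. pattern T \<beta> H x = z})"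
    using pattern_in_PiE[OF assms(2)] by auto
  then show ?thesis
    unfolding freq_def using pattern_fibre_sets[OF assms] assms finite_B
    by (simp, intro finite_measure_finite_Union) (auto simp: disjoint_family_on_def finite_PiE)
qed

lemma sum_freq:
  assumes "finite H" "H \<subseteq> carrier (free_group r)"
  shows "(\<Sum>z\<in>H \<rightarrow>\<^sub>E B. freq H z) = 1"
  using prob_pattern_event[OF assms, of "\<lambda>_. True"] prob_space.prob_space[OF prob_M] by simp

lemma measure_marginal_itinerary:
  assumes "finite H" "H \<subseteq> carrier (free_group r)" "z \<in> H \<rightarrow>\<^sub>E B"
  shows "measure (marginal H B (itinerary_distr r B M T \<beta>)) {z} = freq H z"
proof -
  let ?C = "config_space (carrier (free_group r)) B"
  have it: "itinerary r T \<beta> \<in> measurable M ?C"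
    unfolding config_space_def itinerary_def by (intro measurable_restrict step_measurable)
  have res: "(\<lambda>\<omega>. restrict \<omega> H) \<in> measurable ?C (config_space H B)"
    unfolding config_space_def by (rule measurable_restrict_subset[OF assms(2)])
  have "{z} = (\<Pi>\<^sub>E g\<in>H. {z g})"
    using PiE_singleton[of z H] assms(3) by (simp add: PiE_iff)
  then have sing: "{z} \<in> sets (config_space H B)"
    unfolding config_space_def using assms
    by (auto intro!: sets_PiM_I_finite)
  have "measure (marginal H B (itinerary_distr r B M T \<beta>)) {z}
      = measure (distr M (config_space H B) ((\<lambda>\<omega>. restrict \<omega> H) \<circ> itinerary r T \<beta>)) {z}"
    by (simp add: marginal_def itinerary_distr_def distr_distr[OF res it])
  also have "\<dots> = measure M (((\<lambda>\<omega>. restrict \<omega> H) \<circ> itinerary r T \<beta>) -` {z} \<inter> space M)"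
    by (rule measure_distr[OF measurable_comp[OF it res] sing])
  also have "((\<lambda>\<omega>. restrict \<omega> H) \<circ> itinerary r T \<beta>) -` {z} \<inter> space M
      = {x \<in> space M. pattern T \<beta> H x = z}"
  proof -
    have "restrict (itinerary r T \<beta> x) H = pattern T \<beta> H x" for x
      using assms(2) by (auto simp: itinerary_def pattern_def fun_eq_iff)
    then show ?thesis by auto
  qed
  finally show ?thesis by (simp add: freq_def)
qed

end

section \<open>Measure-preserving systems with an observable\<close>

locale observed_mp_system =
  fixes r :: nat and M :: "'a measure" and T :: "word \<Rightarrow> 'a \<Rightarrow> 'a"
    and B :: "'b set" and \<beta> :: "'a \<Rightarrow> 'b"
  assumes system: "mp_system r M T" and finite_alphabet: "finite B"
    and observable: "\<beta> \<in> measurable M (count_space B)"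
begin

lemma T_automorphism: "g \<in> carrier (free_group r) \<Longrightarrow> T g \<in> mp_automorphisms M"
  using hom_in_carrier[of T "free_group r" "mp_aut_group M" g] system
  by (simp add: mp_system_def mp_aut_group_def)

lemma T_measurable: "g \<in> carrier (free_group r) \<Longrightarrow> T g \<in> measurable M M"
  using T_automorphism by (simp add: mp_automorphisms_def)

lemma T_space: "g \<in> carrier (free_group r) \<Longrightarrow> x \<in> space M \<Longrightarrow> T g x \<in> space M"
  by (rule measurable_space[OF T_measurable])

lemma T_word_mult:
  assumes "g \<in> carrier (free_group r)" "h \<in> carrier (free_group r)" "x \<in> space M"
  shows "T (word_mult g h) x = T g (T h x)"
proof -
  have "T (word_mult g h) = T g \<otimes>\<^bsub>mp_aut_group M\<^esub> T h"
    using hom_mult[of T "free_group r" "mp_aut_group M" g h] system assms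
    by (simp add: mp_system_def)
  also have "\<dots> = compose (space M) (T g) (T h)"
    using T_automorphism assms by (simp add: mp_aut_group_def BijGroup_def mp_automorphisms_def)
  finally show ?thesis using assms by (simp add: compose_def)
qed

lemma T_Nil:
  assumes "x \<in> space M"
  shows "T [] x = x"
proof -
  have "inj_on (T []) (space M)"
    using T_automorphism[of "[]"] by (simp add: mp_automorphisms_def Bij_def bij_betw_def)
  moreover have "T [] (T [] x) = T [] x" using T_word_mult[of "[]" "[]" x] assms by simp
  ultimately show ?thesis using assms T_space[of "[]" x] by (simp add: inj_on_eq_iff)
qed

lemma measure_T_vimage:
  assumes "g \<in> carrier (free_group r)" "A \<in> sets M"
  shows "measure M {x \<in> space M. T g x \<in> A} = measure M A"
proof -
  have "distr M M (T g) = M"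
    using T_automorphism[OF assms(1)] by (simp add: mp_automorphisms_def)
  then have "measure M A = measure (distr M M (T g)) A" by simp
  also have "\<dots> = measure M (T g -` A \<inter> space M)"
    using T_measurable assms by (simp add: measure_distr)
  also have "T g -` A \<inter> space M = {x \<in> space M. T g x \<in> A}" by auto
  finally show ?thesis by simp
qed

sublocale observed_process r M T B \<beta>
proof (rule observed_process.intro)
  show "prob_space M" using system by (simp add: mp_system_def standard_prob_space_def)
  show "finite B" by (rule finite_alphabet)
  fix g assume "g \<in> carrier (free_group r)"
  then show "(\<lambda>x. \<beta> (T g x)) \<in> measurable M (count_space B)"
    using measurable_compose[OF T_measurable observable] by simp
qed

end

section \<open>Correctly labelled steps determine the patterns\<close>

lemma letter_in_carrier: "[a] \<in> carrier (free_group r) \<longleftrightarrow> fst a \<in> {1..r}"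
  by (simp add: in_carrier_free_group reduced_word_def)

context
  fixes \<sigma> n r
  assumes \<sigma>: "\<sigma> \<in> hom (free_group r) (sym_group n)"
begin

lemma hom_permutes: "g \<in> carrier (free_group r) \<Longrightarrow> \<sigma> g permutes {1..n}"
  using hom_in_carrier[OF \<sigma>, of g] by (simp add: sym_group_carrier)

lemma hom_word_mult:
  "g \<in> carrier (free_group r) \<Longrightarrow> h \<in> carrier (free_group r) \<Longrightarrow>
    \<sigma> (word_mult g h) j = \<sigma> g (\<sigma> h j)"
  using hom_mult[OF \<sigma>, of g h] by (simp add: sym_group_mult)

lemma hom_Nil: "\<sigma> [] j = j"
proof -
  have "\<sigma> [] (\<sigma> [] j) = \<sigma> [] j" using hom_word_mult[of "[]" "[]" j] by simp
  then show ?thesis using permutes_inj[OF hom_permutes[of "[]"]] by (simp add: inj_eq)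
qed

lemma card_hom_preimage:
  assumes "g \<in> carrier (free_group r)" "A \<subseteq> {1..n}"
  shows "card {j \<in> {1..n}. \<sigma> g j \<in> A} \<le> card A"
proof (rule card_inj_on_le[of "\<sigma> g"])
  show "inj_on (\<sigma> g) {j \<in> {1..n}. \<sigma> g j \<in> A}"
    using permutes_inj_on[OF hom_permutes[OF assms(1)]] .
  show "finite A" using assms(2) by (rule finite_subset) simp
qed auto

end

lemma inverse_letter_mult: "word_mult [inv_letter a] [a] = []" "word_mult [a] [inv_letter a] = []"
  by simp_all

context observed_mp_system
begin

text \<open>
  The labels at both ends of the step from \<open>j\<close> to \<open>\<sigma> u j\<close> are those of a genuine point \<open>x\<close> and of
  \<open>T u x\<close>. Such labels agree wherever they describe the same coordinate; the point \<open>x\<close> is the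
  witness of this consistency.
\<close>

definition step_realised ::
    "nat \<Rightarrow> (word \<Rightarrow> nat \<Rightarrow> nat) \<Rightarrow> (nat \<Rightarrow> word \<Rightarrow> 'b) \<Rightarrow> word \<Rightarrow> nat \<Rightarrow> bool" where
  "step_realised k \<sigma> lab u j \<longleftrightarrow> (\<exists>x\<in>space M.
     lab j = pattern T \<beta> (free_ball r [] k) x \<and>
     lab (\<sigma> u j) = pattern T \<beta> (free_ball r [] k) (T u x))"

text \<open>
  If \<open>x\<close> is a witness for a step, then \<open>T [a] x\<close> is a witness for the same step taken backwards. So
  counting the unrealised steps of the generators is enough.
\<close>

lemma step_realised_inverse:
  assumes \<sigma>: "\<sigma> \<in> hom (free_group r) (sym_group n)" and a: "fst a \<in> {1..r}"
    and step: "step_realised k \<sigma> lab [a] (\<sigma> [inv_letter a] j)"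
  shows "step_realised k \<sigma> lab [inv_letter a] j"
proof -
  have c: "[a] \<in> carrier (free_group r)" "[inv_letter a] \<in> carrier (free_group r)"
    using a by (simp_all only: letter_in_carrier fst_inv_letter)
  have j: "\<sigma> [a] (\<sigma> [inv_letter a] j) = j"
    using hom_word_mult[OF \<sigma> c, of j] hom_Nil[OF \<sigma>] by (simp only: inverse_letter_mult)
  obtain x where x: "x \<in> space M"
      "lab (\<sigma> [inv_letter a] j) = pattern T \<beta> (free_ball r [] k) x"
      "lab j = pattern T \<beta> (free_ball r [] k) (T [a] x)"
    using step unfolding step_realised_def j by blast
  have "T [inv_letter a] (T [a] x) = x"
    using T_word_mult[OF c(2,1) x(1)] T_Nil[OF x(1)] by (simp only: inverse_letter_mult)
  then show ?thesis
    unfolding step_realised_def using x T_space[OF c(1) x(1)] by (intro bexI[of _ "T [a] x"]) simp_all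
qed

lemma few_unrealised_letters:
  assumes \<sigma>: "\<sigma> \<in> hom (free_group r) (sym_group n)"
    and b: "\<And>i. i \<in> {1..r} \<Longrightarrow> card {j \<in> {1..n}. \<not> step_realised k \<sigma> lab (gen i) j} \<le> b"
    and a: "fst a \<in> {1..r}"
  shows "card {j \<in> {1..n}. \<not> step_realised k \<sigma> lab [a] j} \<le> b"
proof (cases "snd a")
  case True
  then have "[a] = gen (fst a)" by (cases a) (simp add: gen_def)
  then show ?thesis using b[OF a] by simp
next
  case False
  then have ga: "[inv_letter a] = gen (fst a)" by (cases a) (simp add: gen_def inv_letter_def)
  let ?A = "{j \<in> {1..n}. \<not> step_realised k \<sigma> lab (gen (fst a)) j}"
  have c: "[a] \<in> carrier (free_group r)" using a by (simp only: letter_in_carrier)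
  have "{j \<in> {1..n}. \<not> step_realised k \<sigma> lab [a] j} \<subseteq> {j \<in> {1..n}. \<sigma> [a] j \<in> ?A}"
  proof safe
    fix j assume j: "j \<in> {1..n}" "\<not> step_realised k \<sigma> lab [a] j"
    show "\<sigma> [a] j \<in> {1..n}" using permutes_in_image[OF hom_permutes[OF \<sigma> c]] j(1) by simp
    assume "step_realised k \<sigma> lab (gen (fst a)) (\<sigma> [a] j)"
    then have "step_realised k \<sigma> lab [inv_letter (inv_letter a)] j"
      using a by (intro step_realised_inverse[OF \<sigma>, of "inv_letter a"])
        (simp_all only: ga fst_inv_letter inv_letter_inv_letter)
    then show False using j(2) by simp
  qed
  then have "card {j \<in> {1..n}. \<not> step_realised k \<sigma> lab [a] j} \<le> card {j \<in> {1..n}. \<sigma> [a] j \<in> ?A}"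
    by (intro card_mono) simp_all
  also have "\<dots> \<le> card ?A" by (rule card_hom_preimage[OF \<sigma> c]) auto
  also have "\<dots> \<le> b" by (rule b[OF a])
  finally show ?thesis .
qed

text \<open>
  Call \<open>j\<close> exceptional at radius \<open>l\<close> if some coordinate of its label at distance at most \<open>l\<close> is
  wrong, that is, differs from the observable at the point reached. Write a word of length \<open>l + 1\<close> as
  \<open>h\<close> applied after a letter \<open>a\<close>. If the step \<open>a\<close> from \<open>j\<close> is realised, then the label of \<open>j\<close> at
  \<open>ha\<close> is the label of \<open>\<sigma> a j\<close> at \<open>h\<close>, and so it is right unless \<open>\<sigma> a j\<close> is exceptional at radius
  \<open>l\<close>. Hence every increase of the radius adds, for each of the \<open>2 * r\<close> letters, at most \<open>b\<close>
  unrealised steps and one preimage of the previous exceptional set. The summand \<open>b\<close> on the left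
  turns this recursion into multiplication by \<open>2 * r + 1\<close>.
\<close>

lemma labels_are_patterns:
  assumes \<sigma>: "\<sigma> \<in> hom (free_group r) (sym_group n)"
    and b: "\<And>i. i \<in> {1..r} \<Longrightarrow> card {j \<in> {1..n}. \<not> step_realised k \<sigma> lab (gen i) j} \<le> b"
    and y: "\<And>j. j \<in> {1..n} \<Longrightarrow> y j = lab j []"
  shows "card {j \<in> {1..n}. \<exists>g\<in>free_ball r [] k. y (\<sigma> g j) \<noteq> lab j g} + b \<le> b * (2 * r + 1) ^ k"
proof -
  let ?F = "carrier (free_group r)"
  define Exc where
    "Exc l = {j \<in> {1..n}. \<exists>g\<in>?F. length g \<le> l \<and> y (\<sigma> g j) \<noteq> lab j g}" for l
  define S :: "letter set" where "S = {1..r} \<times> UNIV"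
  have S: "finite S" "card S = 2 * r" by (simp_all add: S_def)
  have fin: "finite (Exc l)" for l by (simp add: Exc_def)
  have step: "Exc (Suc l) \<subseteq> Exc l \<union>
      (\<Union>a\<in>S. {j \<in> {1..n}. \<not> step_realised k \<sigma> lab [a] j} \<union> {j \<in> {1..n}. \<sigma> [a] j \<in> Exc l})"
    if "Suc l \<le> k" for l
  proof
    fix j assume "j \<in> Exc (Suc l)"
    then obtain g where j: "j \<in> {1..n}"
      and g: "g \<in> ?F" "length g \<le> Suc l" "y (\<sigma> g j) \<noteq> lab j g"
      by (auto simp: Exc_def)
    show "j \<in> Exc l \<union>
      (\<Union>a\<in>S. {j \<in> {1..n}. \<not> step_realised k \<sigma> lab [a] j} \<union> {j \<in> {1..n}. \<sigma> [a] j \<in> Exc l})"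
    proof (cases g rule: rev_cases)
      case Nil
      then have "j \<in> Exc l" using j g Nil unfolding Exc_def by (auto intro!: bexI[of _ "[]"])
      then show ?thesis by simp
    next
      case (snoc h a)
      have red: "reduced_word (h @ [a])" using g(1) snoc by (simp add: in_carrier_free_group)
      have prod: "word_mult h [a] = g" using word_mult_reduced_append[OF red] snoc by simp
      have "reduced_word h" using red by (simp add: reduced_word_def successively_append_iff)
      then have h: "h \<in> ?F" and a: "fst a \<in> {1..r}"
        using g(1) snoc by (auto simp: in_carrier_free_group)
      have ca: "[a] \<in> ?F" using a by (simp only: letter_in_carrier)
      have aS: "a \<in> S" using a by (cases a) (simp add: S_def)
      have "\<sigma> [a] j \<in> Exc l" if real: "step_realised k \<sigma> lab [a] j"
      proof -
        obtain x where x: "x \<in> space M"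
            "lab j = pattern T \<beta> (free_ball r [] k) x"
            "lab (\<sigma> [a] j) = pattern T \<beta> (free_ball r [] k) (T [a] x)"
          using real unfolding step_realised_def by blast
        have balls: "h \<in> free_ball r [] k" "g \<in> free_ball r [] k"
          using h g \<open>Suc l \<le> k\<close> snoc by (simp_all add: free_ball_one)
        have "lab (\<sigma> [a] j) h = \<beta> (T h (T [a] x))" using x(3) balls by (simp add: pattern_def)
        also have "T h (T [a] x) = T g x" using T_word_mult[OF h ca x(1)] prod by simp
        also have "\<beta> (T g x) = lab j g" using x(2) balls by (simp add: pattern_def)
        also have "\<dots> \<noteq> y (\<sigma> g j)" using g(3) by simp
        finally have "lab (\<sigma> [a] j) h \<noteq> y (\<sigma> g j)" .
        moreover have "\<sigma> g j = \<sigma> h (\<sigma> [a] j)" using hom_word_mult[OF \<sigma> h ca] prod by simp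
        moreover have "\<sigma> [a] j \<in> {1..n}"
          using permutes_in_image[OF hom_permutes[OF \<sigma> ca]] j by simp
        ultimately show ?thesis unfolding Exc_def using h g(2) snoc by auto
      qed
      then show ?thesis using aS j by blast
    qed
  qed
  have "card (Exc l) + b \<le> b * (2 * r + 1) ^ l" if "l \<le> k" for l
    using that
  proof (induction l)
    case 0
    have "Exc 0 = {}" using y by (auto simp: Exc_def hom_Nil[OF \<sigma>])
    then show ?case by simp
  next
    case (Suc l)
    have "card (Exc (Suc l)) \<le> card (Exc l \<union>
      (\<Union>a\<in>S. {j \<in> {1..n}. \<not> step_realised k \<sigma> lab [a] j} \<union> {j \<in> {1..n}. \<sigma> [a] j \<in> Exc l}))"
      using step[OF Suc.prems] fin S by (intro card_mono) simp_all
    also have "\<dots> \<le> card (Exc l) + card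
      (\<Union>a\<in>S. {j \<in> {1..n}. \<not> step_realised k \<sigma> lab [a] j} \<union> {j \<in> {1..n}. \<sigma> [a] j \<in> Exc l})"
      by (rule card_Un_le)
    also have "\<dots> \<le> card (Exc l) + (\<Sum>a\<in>S. b + card (Exc l))"
    proof (intro add_left_mono order_trans[OF card_UN_le[OF S(1)]] sum_mono order_trans[OF card_Un_le]
        add_mono)
      fix a assume "a \<in> S"
      then have a: "fst a \<in> {1..r}" by (auto simp: S_def)
      show "card {j \<in> {1..n}. \<not> step_realised k \<sigma> lab [a] j} \<le> b"
        by (rule few_unrealised_letters[OF \<sigma> _ a]) (rule b)
      show "card {j \<in> {1..n}. \<sigma> [a] j \<in> Exc l} \<le> card (Exc l)"
        using a by (intro card_hom_preimage[OF \<sigma>]) (auto simp: letter_in_carrier Exc_def)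
    qed
    also have "\<dots> = card (Exc l) + 2 * r * (b + card (Exc l))" using S by simp
    finally have "card (Exc (Suc l)) + b \<le> (2 * r + 1) * (card (Exc l) + b)"
      by (simp add: algebra_simps)
    also have "\<dots> \<le> (2 * r + 1) * (b * (2 * r + 1) ^ l)"
      using Suc by (intro mult_left_mono) simp_all
    finally show ?case by (simp only: power_Suc ac_simps)
  qed
  moreover have "{j \<in> {1..n}. \<exists>g\<in>free_ball r [] k. y (\<sigma> g j) \<noteq> lab j g} = Exc k"
    by (auto simp: Exc_def free_ball_one)
  ultimately show ?thesis by simp
qed

end

section \<open>Rounding the frequencies\<close>

context observed_process
begin

definition copies :: "nat \<Rightarrow> word set \<Rightarrow> (word \<Rightarrow> 'b) \<Rightarrow> nat" where
  "copies n H z = nat \<lfloor>real n * freq H z\<rfloor>"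

lemma freq_nonneg: "0 \<le> freq H z"
  by (simp add: freq_def)

lemma copies_le: "real (copies n H z) \<le> real n * freq H z"
  unfolding copies_def by (rule of_nat_floor) (simp add: freq_nonneg)

lemma copies_ge: "real n * freq H z - 1 \<le> real (copies n H z)"
  unfolding copies_def by linarith

lemma freq_pos_imp_realised:
  assumes "freq H z \<noteq> 0"
  shows "\<exists>x\<in>space M. pattern T \<beta> H x = z"
proof (rule ccontr)
  assume "\<not> ?thesis"
  then have "{x \<in> space M. pattern T \<beta> H x = z} = {}" by auto
  then show False using assms unfolding freq_def by (simp only: measure_empty)
qed

text \<open>
  Rounding down never lets the copies of the patterns in an event exceed the rounded expectation of
  the whole event. With the event that the source, or the target, of the window is \<open>a\<close>, this is
  what makes the edges fit onto the vertices.
\<close>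

lemma sum_copies_le:
  assumes "finite H" "H \<subseteq> carrier (free_group r)"
  shows "(\<Sum>z | z \<in> H \<rightarrow>\<^sub>E B \<and> P z. copies n H z)
    \<le> nat \<lfloor>real n * measure M {x \<in> space M. P (pattern T \<beta> H x)}\<rfloor>"
proof (rule le_nat_floor)
  have "real (\<Sum>z | z \<in> H \<rightarrow>\<^sub>E B \<and> P z. copies n H z)
      \<le> (\<Sum>z | z \<in> H \<rightarrow>\<^sub>E B \<and> P z. real n * freq H z)"
    unfolding of_nat_sum by (intro sum_mono copies_le)
  then show "real (\<Sum>z | z \<in> H \<rightarrow>\<^sub>E B \<and> P z. copies n H z)
      \<le> real n * measure M {x \<in> space M. P (pattern T \<beta> H x)}"
    by (simp only: prob_pattern_event[OF assms] sum_distrib_left)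
qed

lemma B_nonempty: "B \<noteq> {}"
proof -
  obtain x where "x \<in> space M" using prob_space.not_empty[OF prob_M] by auto
  then have "\<beta> (T [] x) \<in> B" using measurable_space[OF step_measurable[of "[]"]] by simp
  then show ?thesis by auto
qed

text \<open>
  Each pattern loses less than one copy to rounding, so at most as many copies are missing as there
  are patterns.
\<close>

lemma sum_copies_ge:
  assumes "finite H" "H \<subseteq> carrier (free_group r)" "card H \<le> c"
  shows "n \<le> (\<Sum>z\<in>H \<rightarrow>\<^sub>E B. copies n H z) + card B ^ c"
proof -
  have B: "1 \<le> card B" using B_nonempty finite_B by (simp add: Suc_le_eq card_gt_0_iff)
  have "real n - real (card (H \<rightarrow>\<^sub>E B)) = (\<Sum>z\<in>H \<rightarrow>\<^sub>E B. real n * freq H z - 1)"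
    using sum_freq[OF assms(1,2)] by (simp add: sum_subtractf flip: sum_distrib_left)
  also have "\<dots> \<le> (\<Sum>z\<in>H \<rightarrow>\<^sub>E B. real (copies n H z))"
    by (intro sum_mono copies_ge)
  finally have "real n \<le> real ((\<Sum>z\<in>H \<rightarrow>\<^sub>E B. copies n H z) + card (H \<rightarrow>\<^sub>E B))" by simp
  then have "n \<le> (\<Sum>z\<in>H \<rightarrow>\<^sub>E B. copies n H z) + card (H \<rightarrow>\<^sub>E B)" by (simp only: of_nat_le_iff)
  also have "card (H \<rightarrow>\<^sub>E B) \<le> card B ^ c"
    using power_increasing[OF assms(3) B] by (simp add: card_funcsetE[OF assms(1)])
  finally show ?thesis by simp
qed

text \<open>
  The edges that the model should have for the generator \<open>s\<^sub>i\<close>: the second components tell the copies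
  of a window pattern apart.
\<close>

definition edges :: "nat \<Rightarrow> nat \<Rightarrow> nat \<Rightarrow> ((word \<Rightarrow> 'b) \<times> nat) set" where
  "edges n k i = (SIGMA z:(window r k i \<rightarrow>\<^sub>E B). {..<copies n (window r k i) z})"

lemma finite_edges: "finite (edges n k i)"
  using window_bound finite_B by (simp add: edges_def finite_PiE)

lemma card_edges_fibre:
  "card {e \<in> edges n k i. P (fst e)}
    = (\<Sum>z | z \<in> window r k i \<rightarrow>\<^sub>E B \<and> P z. copies n (window r k i) z)"
proof -
  have "{e \<in> edges n k i. P (fst e)} =
      (SIGMA z:{z \<in> window r k i \<rightarrow>\<^sub>E B. P z}. {..<copies n (window r k i) z})"
    by (auto simp: edges_def)
  then show ?thesis using window_bound finite_B by (simp add: finite_PiE)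
qed

lemma card_edges_le:
  assumes "i \<in> {1..r}"
  shows "card {e \<in> edges n k i. P (fst e)}
    \<le> nat \<lfloor>real n * measure M {x \<in> space M. P (pattern T \<beta> (window r k i) x)}\<rfloor>"
  unfolding card_edges_fibre[where P = P]
  using sum_copies_le[where P = P] window_bound window_carrier[OF assms] by simp

lemma card_edges_ge:
  assumes "i \<in> {1..r}"
  shows "n \<le> card (edges n k i) + card B ^ (2 * (2 * r + 1) ^ k)"
  using sum_copies_ge[of "window r k i" "2 * (2 * r + 1) ^ k" n] window_bound[of r k i]
    window_carrier[OF assms] card_edges_fibre[of n k i "\<lambda>_. True"] by simp

end

section \<open>The finite model\<close>

text \<open>Mass lying below both distributions does not contribute to their distance.\<close>

lemma half_l1_le_common_mass:
  fixes p q c :: "'z \<Rightarrow> real"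
  assumes "\<And>z. z \<in> Z \<Longrightarrow> c z \<le> p z" "\<And>z. z \<in> Z \<Longrightarrow> c z \<le> q z" "sum p Z = 1" "sum q Z = 1"
  shows "(\<Sum>z\<in>Z. \<bar>p z - q z\<bar>) / 2 \<le> 1 - sum c Z"
proof -
  have "(\<Sum>z\<in>Z. \<bar>p z - q z\<bar>) \<le> (\<Sum>z\<in>Z. p z + q z - 2 * c z)"
  proof (rule sum_mono)
    fix z assume "z \<in> Z"
    then show "\<bar>p z - q z\<bar> \<le> p z + q z - 2 * c z" using assms(1,2)[of z] by linarith
  qed
  also have "\<dots> = 2 - 2 * sum c Z"
    using assms by (simp add: sum.distrib sum_subtractf sum_distrib_left)
  finally show ?thesis by simp
qed

definition source :: "nat \<Rightarrow> nat \<Rightarrow> (word \<Rightarrow> 'b) \<Rightarrow> word \<Rightarrow> 'b" where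
  "source r k z = restrict z (free_ball r [] k)"

definition target :: "nat \<Rightarrow> nat \<Rightarrow> nat \<Rightarrow> (word \<Rightarrow> 'b) \<Rightarrow> word \<Rightarrow> 'b" where
  "target r k i z = (\<lambda>h\<in>free_ball r [] k. z (word_mult h (gen i)))"

context observed_mp_system
begin

lemma source_pattern:
  "source r k (pattern T \<beta> (window r k i) x) = pattern T \<beta> (free_ball r [] k) x"
  by (auto simp: source_def pattern_def window_def fun_eq_iff)

lemma target_pattern:
  assumes "i \<in> {1..r}" "x \<in> space M"
  shows "target r k i (pattern T \<beta> (window r k i) x) = pattern T \<beta> (free_ball r [] k) (T (gen i) x)"
proof
  fix h
  show "target r k i (pattern T \<beta> (window r k i) x) h
      = pattern T \<beta> (free_ball r [] k) (T (gen i) x) h"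
  proof (cases "h \<in> free_ball r [] k")
    case True
    then have "word_mult h (gen i) \<in> window r k i" "h \<in> carrier (free_group r)"
      by (simp_all add: window_def free_ball_translate[of r "gen i"] free_ball_one)
    then show ?thesis
      using True T_word_mult[OF _ gen_in_free_group[OF assms(1)] assms(2)]
      by (simp add: target_def pattern_def)
  qed (simp add: target_def pattern_def)
qed

lemma ball_bound: "finite (free_ball r [] k)" "free_ball r [] k \<subseteq> carrier (free_group r)"
  using free_ball_bound by (auto simp: free_ball_one)

lemma card_edges_source:
  assumes "i \<in> {1..r}"
  shows "card {e \<in> edges n k i. source r k (fst e) = a} \<le> copies n (free_ball r [] k) a"
proof -
  have "card {e \<in> edges n k i. source r k (fst e) = a} \<le>
      nat \<lfloor>real n * measure M {x \<in> space M. source r k (pattern T \<beta> (window r k i) x) = a}\<rfloor>"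
    by (rule card_edges_le[OF assms, where P = "\<lambda>z. source r k z = a"])
  then show ?thesis by (simp only: source_pattern copies_def freq_def)
qed

text \<open>
  Here the invariance of the measure enters: \<open>x\<close> and \<open>T\<^bsub>s\<^sub>i\<^esub> x\<close> have equally distributed
  patterns, so the vertices have room for the targets of the edges as well as for their sources.
\<close>

lemma card_edges_target:
  assumes "i \<in> {1..r}"
  shows "card {e \<in> edges n k i. target r k i (fst e) = a} \<le> copies n (free_ball r [] k) a"
proof -
  let ?A = "{x \<in> space M. pattern T \<beta> (free_ball r [] k) x = a}"
  have g: "gen i \<in> carrier (free_group r)" by (rule gen_in_free_group[OF assms])
  have "card {e \<in> edges n k i. target r k i (fst e) = a} \<le>
      nat \<lfloor>real n * measure M {x \<in> space M. target r k i (pattern T \<beta> (window r k i) x) = a}\<rfloor>"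
    by (rule card_edges_le[OF assms, where P = "\<lambda>z. target r k i z = a"])
  also have "{x \<in> space M. target r k i (pattern T \<beta> (window r k i) x) = a}
      = {x \<in> space M. T (gen i) x \<in> ?A}"
    using target_pattern[OF assms] T_space[OF g] by auto
  also have "measure M \<dots> = measure M ?A"
    by (rule measure_T_vimage[OF g pattern_fibre_sets[OF ball_bound]])
  finally show ?thesis by (simp only: copies_def freq_def)
qed

lemma vertex_labelling:
  "\<exists>lab. (\<forall>j\<in>{1..n}. lab j \<in> free_ball r [] k \<rightarrow>\<^sub>E B) \<and>
    (\<forall>a. copies n (free_ball r [] k) a \<le> card {j \<in> {1..n}. lab j = a})"
proof -
  let ?A = "free_ball r [] k \<rightarrow>\<^sub>E B"
  obtain x where x: "x \<in> space M" using prob_space.not_empty[OF prob_M] by auto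
  have sum: "(\<Sum>a\<in>?A. copies n (free_ball r [] k) a) \<le> card {1..n}"
    using sum_copies_le[OF ball_bound[of k], where P = "\<lambda>_. True" and n = n] prob_space.prob_space[OF prob_M] by simp
  have fin: "finite ?A" using ball_bound finite_B by (simp add: finite_PiE)
  obtain lab where lab: "\<forall>j\<in>{1..n}. lab j \<in> ?A"
      "\<forall>a\<in>?A. copies n (free_ball r [] k) a \<le> card {j \<in> {1..n}. lab j = a}"
    using labelling_with_multiplicities[OF finite_atLeastAtMost fin
        pattern_in_PiE[OF ball_bound(2) x] sum] by blast
  have "copies n (free_ball r [] k) a = 0" if "a \<notin> ?A" for a
  proof -
    have "freq (free_ball r [] k) a = 0"
      using freq_pos_imp_realised[of "free_ball r [] k" a] pattern_in_PiE[OF ball_bound(2)] that by auto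
    then show ?thesis by (simp add: copies_def)
  qed
  then have "copies n (free_ball r [] k) a \<le> card {j \<in> {1..n}. lab j = a}" for a
    using lab(2) by (cases "a \<in> ?A") simp_all
  then show ?thesis using lab(1) by (intro exI[of _ lab]) simp
qed

definition realises_edges ::
    "nat \<Rightarrow> nat \<Rightarrow> (nat \<Rightarrow> word \<Rightarrow> 'b) \<Rightarrow> nat \<Rightarrow> (nat \<Rightarrow> nat) \<Rightarrow> ((word \<Rightarrow> 'b) \<times> nat \<Rightarrow> nat) \<Rightarrow> bool"
  where "realises_edges n k lab i \<pi> p \<longleftrightarrow>
    \<pi> permutes {1..n} \<and> inj_on p (edges n k i) \<and> p ` edges n k i \<subseteq> {1..n} \<and>
    (\<forall>e\<in>edges n k i. lab (p e) = source r k (fst e) \<and> lab (\<pi> (p e)) = target r k i (fst e))"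

lemma edges_realisable:
  assumes i: "i \<in> {1..r}"
    and lab: "\<And>a. copies n (free_ball r [] k) a \<le> card {j \<in> {1..n}. lab j = a}"
  shows "\<exists>\<pi> p. realises_edges n k lab i \<pi> p"
proof -
  let ?E = "edges n k i"
  obtain p where p: "inj_on p ?E" "p ` ?E \<subseteq> {1..n}" "\<forall>e\<in>?E. lab (p e) = source r k (fst e)"
    using fibrewise_injection[OF finite_edges finite_atLeastAtMost
        order_trans[OF card_edges_source[OF i] lab]] by blast
  obtain q where q: "inj_on q ?E" "q ` ?E \<subseteq> {1..n}" "\<forall>e\<in>?E. lab (q e) = target r k i (fst e)"
    using fibrewise_injection[OF finite_edges finite_atLeastAtMost
        order_trans[OF card_edges_target[OF i] lab]] by blast
  obtain \<pi> where "\<pi> permutes {1..n}" "\<forall>e\<in>?E. \<pi> (p e) = q e"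
    using matching_extends_to_permutation[OF finite_atLeastAtMost p(1) q(1) p(2) q(2)] by blast
  then show ?thesis using p q by (intro exI[of _ \<pi>] exI[of _ p]) (simp add: realises_edges_def)
qed

text \<open>
  A step along a placed edge is realised, because a pattern of which there is a copy has positive
  probability and so is the pattern of some point.
\<close>

lemma few_unrealised_generator_steps:
  assumes i: "i \<in> {1..r}" and p: "realises_edges n k lab i (\<sigma> (gen i)) p"
  shows "card {j \<in> {1..n}. \<not> step_realised k \<sigma> lab (gen i) j} \<le> card B ^ (2 * (2 * r + 1) ^ k)"
proof -
  let ?E = "edges n k i"
  have "step_realised k \<sigma> lab (gen i) (p e)" if e: "e \<in> ?E" for e
  proof -
    have "0 < copies n (window r k i) (fst e)" using e by (auto simp: edges_def)
    then have "freq (window r k i) (fst e) \<noteq> 0" by (intro notI) (simp add: copies_def)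
    then obtain x where x: "x \<in> space M" "pattern T \<beta> (window r k i) x = fst e"
      using freq_pos_imp_realised by auto
    have "lab (p e) = pattern T \<beta> (free_ball r [] k) x"
      using p e source_pattern[of k i x] x(2) by (simp add: realises_edges_def)
    moreover have "lab (\<sigma> (gen i) (p e)) = pattern T \<beta> (free_ball r [] k) (T (gen i) x)"
      using p e target_pattern[OF i x(1), of k] x(2) by (simp add: realises_edges_def)
    ultimately show ?thesis unfolding step_realised_def using x(1) by (intro bexI[of _ x]) simp_all
  qed
  then have "{j \<in> {1..n}. \<not> step_realised k \<sigma> lab (gen i) j} \<subseteq> {1..n} - p ` ?E" by auto
  then have "card {j \<in> {1..n}. \<not> step_realised k \<sigma> lab (gen i) j} \<le> card ({1..n} - p ` ?E)"
    by (intro card_mono) simp_all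
  also have "\<dots> = n - card ?E"
    using p finite_edges by (simp add: realises_edges_def card_Diff_subset card_image)
  also have "\<dots> \<le> card B ^ (2 * (2 * r + 1) ^ k)" using card_edges_ge[OF i, of n k] by linarith
  finally show ?thesis .
qed

text \<open>
  The part \<open>B(e, k)\<close> of the window is read off the label of the vertex \<open>p e\<close>, the part \<open>B(s\<^sub>i, k)\<close> off
  the label of its image. The premises on \<open>y\<close> say that both labels are true descriptions of the model.
\<close>

lemma model_pattern:
  assumes \<sigma>: "\<sigma> \<in> hom (free_group r) (sym_group n)" and i: "i \<in> {1..r}"
    and p: "realises_edges n k lab i (\<sigma> (gen i)) p" and e: "e \<in> edges n k i"
    and j: "\<And>g. g \<in> free_ball r [] k \<Longrightarrow> y (\<sigma> g (p e)) = lab (p e) g"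
    and j': "\<And>g. g \<in> free_ball r [] k \<Longrightarrow>
      y (\<sigma> g (\<sigma> (gen i) (p e))) = lab (\<sigma> (gen i) (p e)) g"
  shows "pattern \<sigma> y (window r k i) (p e) = fst e"
proof
  fix g
  have lab: "lab (p e) = source r k (fst e)" "lab (\<sigma> (gen i) (p e)) = target r k i (fst e)"
    using p e by (simp_all add: realises_edges_def)
  have z: "fst e \<in> window r k i \<rightarrow>\<^sub>E B" using e by (auto simp: edges_def)
  consider "g \<in> free_ball r [] k" | h where "h \<in> free_ball r [] k" "g = word_mult h (gen i)"
    | "g \<notin> window r k i"
    by (auto simp: window_def free_ball_translate[of r "gen i"])
  then show "pattern \<sigma> y (window r k i) (p e) g = fst e g"
  proof cases
    case 1
    then show ?thesis using j[OF 1] lab(1) by (simp add: pattern_def window_def source_def)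
  next
    case (2 h)
    then have "g \<in> window r k i" "h \<in> carrier (free_group r)"
      by (simp_all add: window_def free_ball_translate[of r "gen i"] free_ball_one)
    then show ?thesis
      using 2 j'[OF 2(1)] lab(2) hom_word_mult[OF \<sigma> _ gen_in_free_group[OF i], of h "p e"]
      by (simp add: pattern_def target_def)
  next
    case 3
    then show ?thesis using PiE_arb[OF z 3] by (simp add: pattern_def)
  qed
qed

text \<open>
  The edges with both ends unexceptional are common mass: there are at most \<open>n\<close> times the true
  frequency of each pattern by rounding down, and each of them is seen in the model at its own vertex.
\<close>

lemma tv_dist_model:
  assumes n: "1 \<le> n" and \<sigma>: "\<sigma> \<in> hom (free_group r) (sym_group n)" and y: "y \<in> {1..n} \<rightarrow>\<^sub>E B"
    and i: "i \<in> {1..r}" and p: "realises_edges n k lab i (\<sigma> (gen i)) p"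
    and X: "X = {j \<in> {1..n}. \<exists>g\<in>free_ball r [] k. y (\<sigma> g j) \<noteq> lab j g}"
  shows "tv_dist (window r k i) B (empirical_distr r B n \<sigma> y) (itinerary_distr r B M T \<beta>)
    \<le> 1 - (real (card (edges n k i)) - 2 * real (card X)) / real n"
proof -
  let ?H = "window r k i" and ?E = "edges n k i" and ?U = "uniform_count_measure {1..n}"
  let ?Z = "?H \<rightarrow>\<^sub>E B"
  have H: "finite ?H" "?H \<subseteq> carrier (free_group r)"
    using window_bound window_carrier[OF i] by simp_all
  have fZ: "finite ?Z" using H finite_B by (simp add: finite_PiE)
  have fX: "finite X" by (simp add: X)
  have perm: "\<sigma> g j \<in> {1..n} \<longleftrightarrow> j \<in> {1..n}" if "g \<in> carrier (free_group r)" for g j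
    using permutes_in_image[OF hom_permutes[OF \<sigma> that]] .
  interpret emp: observed_process r ?U \<sigma> B y
  proof (rule observed_process.intro)
    show "prob_space ?U" using n by (intro prob_space_uniform_count_measure) simp_all
    show "finite B" by (rule finite_B)
    fix g assume g: "g \<in> carrier (free_group r)"
    show "(\<lambda>x. y (\<sigma> g x)) \<in> measurable ?U (count_space B)"
    proof (rule measurableI)
      fix x assume "x \<in> space ?U"
      then show "y (\<sigma> g x) \<in> space (count_space B)"
        using perm[OF g, of x] PiE_mem[OF y, of "\<sigma> g x"] by (simp add: space_uniform_count_measure)
    qed (simp add: sets_uniform_count_measure space_uniform_count_measure)
  qed
  have emp_freq: "emp.freq ?H z = card {j \<in> {1..n}. pattern \<sigma> y ?H j = z} / n" for z
    unfolding emp.freq_def space_uniform_count_measure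
    by (subst measure_uniform_count_measure) auto
  have pE: "inj_on p ?E" "p ` ?E \<subseteq> {1..n}" using p by (simp_all add: realises_edges_def)
  \<comment> \<open>Edges both of whose ends see the model as their labels say.\<close>
  define G where "G = {e \<in> ?E. p e \<notin> X \<and> \<sigma> (gen i) (p e) \<notin> X}"
  have fG: "finite G" using finite_edges by (simp add: G_def)
  have pattern_G: "pattern \<sigma> y ?H (p e) = fst e" if "e \<in> G" for e
  proof (rule model_pattern[OF \<sigma> i p])
    show "e \<in> ?E" using that by (simp add: G_def)
    have "p e \<in> {1..n}" using that pE by (auto simp: G_def)
    then show "y (\<sigma> g (p e)) = lab (p e) g"
        "y (\<sigma> g (\<sigma> (gen i) (p e))) = lab (\<sigma> (gen i) (p e)) g"
      if "g \<in> free_ball r [] k" for g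
      using that \<open>e \<in> G\<close> perm[OF gen_in_free_group[OF i], of "p e"]
      unfolding G_def X by blast+
  qed
  define c where "c z = real (card {e \<in> G. fst e = z}) / real n" for z
  have "c z \<le> emp.freq ?H z" for z
  proof -
    have "card {e \<in> G. fst e = z} \<le> card {j \<in> {1..n}. pattern \<sigma> y ?H j = z}"
    proof (rule card_inj_on_le[of p])
      show "inj_on p {e \<in> G. fst e = z}" by (rule inj_on_subset[OF pE(1)]) (auto simp: G_def)
      show "p ` {e \<in> G. fst e = z} \<subseteq> {j \<in> {1..n}. pattern \<sigma> y ?H j = z}"
        using pattern_G pE(2) by (auto simp: G_def)
    qed simp
    then show ?thesis unfolding c_def emp_freq using n by (intro divide_right_mono) simp_all
  qed
  moreover have "c z \<le> freq ?H z" for z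
  proof -
    have "card {e \<in> G. fst e = z} \<le> card ({z} \<times> {..<copies n ?H z})"
      by (rule card_mono) (auto simp: G_def edges_def)
    then have "real (card {e \<in> G. fst e = z}) \<le> real (copies n ?H z)" by simp
    then have "real (card {e \<in> G. fst e = z}) \<le> freq ?H z * real n"
      using copies_le[of n ?H z] by (simp add: mult.commute)
    then show ?thesis unfolding c_def using n by (simp add: pos_divide_le_eq)
  qed
  ultimately have "(\<Sum>z\<in>?Z. \<bar>emp.freq ?H z - freq ?H z\<bar>) / 2 \<le> 1 - sum c ?Z"
    by (intro half_l1_le_common_mass sum_freq[OF H] emp.sum_freq[OF H])
  moreover have "tv_dist ?H B (empirical_distr r B n \<sigma> y) (itinerary_distr r B M T \<beta>)
      = (\<Sum>z\<in>?Z. \<bar>emp.freq ?H z - freq ?H z\<bar>) / 2"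
    unfolding tv_dist_def empirical_distr_def
    by (intro arg_cong[where f = "\<lambda>s. s / 2"] sum.cong refl)
      (simp only: measure_marginal_itinerary[OF H] emp.measure_marginal_itinerary[OF H])
  ultimately have "tv_dist ?H B (empirical_distr r B n \<sigma> y) (itinerary_distr r B M T \<beta>)
      \<le> 1 - sum c ?Z" by (simp only:)
  also have "sum c ?Z = real (card G) / real n"
  proof -
    have "fst ` G \<subseteq> ?Z" by (auto simp: G_def edges_def)
    from sum.group[OF fG fZ this, of "\<lambda>_. 1::nat"]
    have "(\<Sum>z\<in>?Z. card {e \<in> G. fst e = z}) = card G" by simp
    then show ?thesis unfolding c_def by (simp flip: sum_divide_distrib of_nat_sum)
  qed
  also have "1 - real (card G) / real n \<le> 1 - (real (card ?E) - 2 * real (card X)) / real n"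
  proof -
    have "card {e \<in> ?E. p e \<in> X} \<le> card X"
    proof (rule card_inj_on_le[of p])
      show "inj_on p {e \<in> ?E. p e \<in> X}" by (rule inj_on_subset[OF pE(1)]) auto
    qed (auto simp: fX)
    moreover have "card {e \<in> ?E. \<sigma> (gen i) (p e) \<in> X} \<le> card X"
    proof (rule card_inj_on_le[of "\<sigma> (gen i) \<circ> p"])
      show "inj_on (\<sigma> (gen i) \<circ> p) {e \<in> ?E. \<sigma> (gen i) (p e) \<in> X}"
        using permutes_inj_on[OF hom_permutes[OF \<sigma> gen_in_free_group[OF i]]]
        by (intro comp_inj_on inj_on_subset[OF pE(1), of "{e \<in> ?E. \<sigma> (gen i) (p e) \<in> X}"]) auto
    qed (auto simp: fX)
    moreover have "card ?E \<le> card (G \<union> ({e \<in> ?E. p e \<in> X} \<union> {e \<in> ?E. \<sigma> (gen i) (p e) \<in> X}))"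
      using finite_edges fG by (intro card_mono) (auto simp: G_def)
    moreover have "\<dots> \<le> card G + (card {e \<in> ?E. p e \<in> X} + card {e \<in> ?E. \<sigma> (gen i) (p e) \<in> X})"
      by (intro order_trans[OF card_Un_le] add_left_mono card_Un_le)
    ultimately have "real (card ?E) - 2 * real (card X) \<le> real (card G)" by linarith
    then show ?thesis by (simp add: divide_right_mono)
  qed
  finally show ?thesis .
qed

text \<open>
  At most \<open>N = |B|\<^bsup>2(2r+1)\<^sup>k\<^esup>\<close> edges are missing for each
  generator; they cost \<open>N\<close> directly, and through the exceptional set, which is counted once for each
  end of an edge, another \<open>2 (N (2r+1)\<^sup>k - N)\<close>.
\<close>

theorem finite_model:
  assumes n: "1 \<le> n"
  shows "\<exists>y \<sigma>. y \<in> {1..n} \<rightarrow>\<^sub>E B \<and> \<sigma> \<in> hom (free_group r) (sym_group n) \<and>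
    d_star r B k (empirical_distr r B n \<sigma> y) (itinerary_distr r B M T \<beta>)
      \<le> real r * (2 * real (card B ^ (2 * (2 * r + 1) ^ k) * (2 * r + 1) ^ k) / real n)"
proof -
  define N where "N = card B ^ (2 * (2 * r + 1) ^ k)"
  obtain lab where lab: "\<And>j. j \<in> {1..n} \<Longrightarrow> lab j \<in> free_ball r [] k \<rightarrow>\<^sub>E B"
      "\<And>a. copies n (free_ball r [] k) a \<le> card {j \<in> {1..n}. lab j = a}"
    using vertex_labelling[of n k] by blast
  have "\<forall>i. \<exists>\<pi> p. i \<in> {1..r} \<longrightarrow> realises_edges n k lab i \<pi> p"
    using edges_realisable[OF _ lab(2)] by blast
  from choice[OF this] obtain \<pi> where \<pi>: "\<And>i. i \<in> {1..r} \<Longrightarrow> \<exists>p. realises_edges n k lab i (\<pi> i) p"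
    by blast
  have \<pi>_carrier: "\<pi> i \<in> carrier (sym_group n)" if "i \<in> {1..r}" for i
    using \<pi>[OF that] by (auto simp: sym_group_carrier realises_edges_def)
  have "\<exists>!\<sigma>. \<sigma> \<in> hom (free_group r) (sym_group n) \<inter> extensional (carrier (free_group r)) \<and>
      (\<forall>i\<in>{1..r}. \<sigma> (gen i) = \<pi> i)"
    by (rule group.free_group_universal[OF sym_group_is_group]) (rule \<pi>_carrier)
  then obtain \<sigma> where \<sigma>: "\<sigma> \<in> hom (free_group r) (sym_group n)"
      "\<And>i. i \<in> {1..r} \<Longrightarrow> \<sigma> (gen i) = \<pi> i"
    by blast
  define y where "y = (\<lambda>j\<in>{1..n}. lab j [])"
  define X where "X = {j \<in> {1..n}. \<exists>g\<in>free_ball r [] k. y (\<sigma> g j) \<noteq> lab j g}"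
  have y: "y \<in> {1..n} \<rightarrow>\<^sub>E B"
    using lab(1) by (auto simp: y_def free_ball_one PiE_iff)
  have N: "card {j \<in> {1..n}. \<not> step_realised k \<sigma> lab (gen i) j} \<le> N" if "i \<in> {1..r}" for i
    using \<pi>[OF that] few_unrealised_generator_steps[OF that, of n k lab \<sigma>] \<sigma>(2)[OF that]
    by (auto simp: N_def)
  have "card X + N \<le> N * (2 * r + 1) ^ k"
    unfolding X_def by (rule labels_are_patterns[OF \<sigma>(1) N]) (simp_all add: y_def)
  then have X: "real (card X) + real N \<le> real (N * (2 * r + 1) ^ k)"
    by (simp only: of_nat_add[symmetric] of_nat_le_iff)
  have "tv_dist (window r k i) B (empirical_distr r B n \<sigma> y) (itinerary_distr r B M T \<beta>)
      \<le> 2 * real (N * (2 * r + 1) ^ k) / real n" if i: "i \<in> {1..r}" for i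
  proof -
    obtain p where p: "realises_edges n k lab i (\<sigma> (gen i)) p" using \<pi>[OF i] \<sigma>(2)[OF i] by auto
    have "tv_dist (window r k i) B (empirical_distr r B n \<sigma> y) (itinerary_distr r B M T \<beta>)
        \<le> 1 - (real (card (edges n k i)) - 2 * real (card X)) / real n"
      by (rule tv_dist_model[OF n \<sigma>(1) y i p X_def])
    also have "\<dots> = (real n - real (card (edges n k i)) + 2 * real (card X)) / real n"
      using n by (simp add: field_simps)
    also have "\<dots> \<le> 2 * real (N * (2 * r + 1) ^ k) / real n"
    proof (rule divide_right_mono)
      have "real n \<le> real (card (edges n k i)) + real N"
        using card_edges_ge[OF i, of n k] unfolding N_def by linarith
      then show "real n - real (card (edges n k i)) + 2 * real (card X) \<le> 2 * real (N * (2 * r + 1) ^ k)"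
        using X by linarith
    qed simp
    finally show ?thesis .
  qed
  then have "d_star r B k (empirical_distr r B n \<sigma> y) (itinerary_distr r B M T \<beta>)
      \<le> (\<Sum>i=1..r. 2 * real (N * (2 * r + 1) ^ k) / real n)"
    unfolding d_star_def one_free_group window_def[symmetric] by (intro sum_mono)
  also have "\<dots> = real r * (2 * real (N * (2 * r + 1) ^ k) / real n)" by simp
  finally show ?thesis unfolding N_def using y \<sigma>(1) by blast
qed

end

section \<open>The number of patterns is subpolynomial\<close>

lemma power_le_sqrt_ln:
  fixes m :: "nat \<Rightarrow> nat" and D :: nat
  assumes D: "2 \<le> D" and m: "(\<lambda>n. real (m n)) \<in> o(\<lambda>n. ln (ln (real n)))"
  shows "\<forall>\<^sub>F n in sequentially. real D ^ m n \<le> sqrt (ln (real n))"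
proof -
  have lnD: "0 < ln (real D)" using D by simp
  have "\<forall>\<^sub>F n in sequentially. norm (real (m n)) \<le> 1 / (2 * ln (real D)) * norm (ln (ln (real n)))"
    using lnD by (intro landau_o.smallD[OF m]) simp
  moreover have "\<forall>\<^sub>F n::nat in sequentially. 0 < ln (ln (real n))" by real_asymp
  moreover have "\<forall>\<^sub>F n::nat in sequentially. 0 < ln (real n)" by real_asymp
  ultimately show ?thesis
  proof eventually_elim
    case (elim n)
    have "real D ^ m n = exp (real (m n) * ln (real D))"
      using D by (simp add: exp_of_nat_mult)
    also have "\<dots> \<le> exp (ln (ln (real n)) / 2)"
      using elim lnD by (simp add: field_simps)
    also have "\<dots> = sqrt (ln (real n))"
      using elim(3) by (simp add: ln_sqrt[symmetric])
    finally show ?case .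
  qed
qed

text \<open>
  With \<open>D = 2 * r + 1\<close> the balls of radius \<open>m n\<close> eventually have at most \<open>sqrt (ln n)\<close> elements, so
  the number of patterns is \<open>exp (O (sqrt (ln n)))\<close>, which is \<open>n\<close> to a power tending to \<open>0\<close>.
\<close>

lemma pattern_count_negligible:
  fixes m :: "nat \<Rightarrow> nat" and D b :: nat
  assumes D: "2 \<le> D" and b: "1 \<le> b" and m: "(\<lambda>n. real (m n)) \<in> o(\<lambda>n. ln (ln (real n)))"
  shows "(\<lambda>n. real (b ^ (2 * D ^ m n) * D ^ m n) / real n) \<in> O(\<lambda>n. 1 / ln (real n))"
proof -
  \<comment> \<open>The summand \<open>1\<close> makes the exponent positive also for \<open>b = 1\<close>.\<close>
  define c where "c = 2 * ln (real b) + 1"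
  have c: "0 < c" using b by (simp add: c_def add_nonneg_pos)
  have "(\<lambda>n. real (b ^ (2 * D ^ m n) * D ^ m n) / real n)
      \<in> O(\<lambda>n. exp (c * sqrt (ln (real n))) * sqrt (ln (real n)) / real n)"
  proof (rule landau_o.big_mono)
    show "\<forall>\<^sub>F n in sequentially. norm (real (b ^ (2 * D ^ m n) * D ^ m n) / real n)
        \<le> norm (exp (c * sqrt (ln (real n))) * sqrt (ln (real n)) / real n)"
      using power_le_sqrt_ln[OF D m]
    proof eventually_elim
      case (elim n)
      have "real (b ^ (2 * D ^ m n)) = exp (real (2 * D ^ m n) * ln (real b))"
        using b by (subst exp_of_nat_mult) simp
      also have "\<dots> \<le> exp (c * sqrt (ln (real n)))"
      proof -
        have "real (2 * D ^ m n) * ln (real b) = (2 * ln (real b)) * real D ^ m n" by simp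
        also have "\<dots> \<le> c * real D ^ m n" by (intro mult_right_mono) (simp_all add: c_def)
        also have "\<dots> \<le> c * sqrt (ln (real n))" using elim c by simp
        finally show ?thesis by simp
      qed
      finally have "real (b ^ (2 * D ^ m n)) * real (D ^ m n)
          \<le> exp (c * sqrt (ln (real n))) * sqrt (ln (real n))"
        using elim by (intro mult_mono) simp_all
      then show ?case using order_trans[OF _ elim, of 0] by (simp add: divide_right_mono abs_mult)
    qed
  qed
  also have "(\<lambda>n::nat. exp (c * sqrt (ln (real n))) * sqrt (ln (real n)) / real n) \<in> O(\<lambda>n. 1 / ln (real n))"
    using c by real_asymp
  finally show ?thesis .
qed

section \<open>Convergence along a slowly growing radius\<close>

lemma d_star_nonneg: "0 \<le> d_star r B k \<nu> \<nu>'"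
  unfolding d_star_def tv_dist_def by (intro sum_nonneg divide_nonneg_nonneg) simp_all

theorem proposition2:
  fixes r :: nat and M :: "'a measure" and T :: "word \<Rightarrow> 'a \<Rightarrow> 'a"
    and B :: "'b set" and \<beta> :: "'a \<Rightarrow> 'b" and m :: "nat \<Rightarrow> nat"
  assumes "r \<ge> 1"
    and "mp_system r M T"
    and "finite B" and "\<beta> \<in> measurable M (count_space B)"
    and "filterlim m at_top sequentially"
    and "(\<lambda>n. real (m n)) \<in> o(\<lambda>n. ln (ln (real n)))"
  shows "\<exists>(y :: nat \<Rightarrow> nat \<Rightarrow> 'b) (\<sigma> :: nat \<Rightarrow> word \<Rightarrow> nat \<Rightarrow> nat).
    (\<forall>n\<ge>1. y n \<in> {1..n} \<rightarrow>\<^sub>E B \<and> \<sigma> n \<in> hom (free_group r) (sym_group n)) \<and>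
    (\<lambda>n. d_star r B (m n) (empirical_distr r B n (\<sigma> n) (y n)) (itinerary_distr r B M T \<beta>))
      \<in> O(\<lambda>n. 1 / ln (real n))"
proof -
  interpret observed_mp_system r M T B \<beta> by (rule observed_mp_system.intro) (rule assms)+
  define f where "f n = real (card B ^ (2 * (2 * r + 1) ^ m n) * (2 * r + 1) ^ m n) / real n" for n
  have "\<forall>n. \<exists>y \<sigma>. n \<ge> 1 \<longrightarrow> y \<in> {1..n} \<rightarrow>\<^sub>E B \<and> \<sigma> \<in> hom (free_group r) (sym_group n) \<and>
      d_star r B (m n) (empirical_distr r B n \<sigma> y) (itinerary_distr r B M T \<beta>) \<le> 2 * real r * f n"
  proof
    fix n
    show "\<exists>y \<sigma>. n \<ge> 1 \<longrightarrow> y \<in> {1..n} \<rightarrow>\<^sub>E B \<and> \<sigma> \<in> hom (free_group r) (sym_group n) \<and>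
        d_star r B (m n) (empirical_distr r B n \<sigma> y) (itinerary_distr r B M T \<beta>) \<le> 2 * real r * f n"
      using finite_model[of n "m n"] by (simp add: f_def mult.assoc mult.left_commute)
  qed
  from choice[OF this] obtain y where "\<forall>n. \<exists>\<sigma>. n \<ge> 1 \<longrightarrow> y n \<in> {1..n} \<rightarrow>\<^sub>E B \<and>
      \<sigma> \<in> hom (free_group r) (sym_group n) \<and>
      d_star r B (m n) (empirical_distr r B n \<sigma> (y n)) (itinerary_distr r B M T \<beta>) \<le> 2 * real r * f n"
    by blast
  from choice[OF this] obtain \<sigma> where model: "\<And>n. n \<ge> 1 \<Longrightarrow> y n \<in> {1..n} \<rightarrow>\<^sub>E B \<and>
      \<sigma> n \<in> hom (free_group r) (sym_group n) \<and>
      d_star r B (m n) (empirical_distr r B n (\<sigma> n) (y n)) (itinerary_distr r B M T \<beta>)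
        \<le> 2 * real r * f n"
    by blast
  have "(\<lambda>n. d_star r B (m n) (empirical_distr r B n (\<sigma> n) (y n)) (itinerary_distr r B M T \<beta>))
      \<in> O(\<lambda>n. 2 * real r * f n)"
  proof (rule landau_o.big_mono)
    show "\<forall>\<^sub>F n in sequentially.
        norm (d_star r B (m n) (empirical_distr r B n (\<sigma> n) (y n)) (itinerary_distr r B M T \<beta>))
          \<le> norm (2 * real r * f n)"
      using eventually_ge_at_top[of 1]
    proof eventually_elim
      case (elim n)
      have "0 \<le> d_star r B (m n) (empirical_distr r B n (\<sigma> n) (y n)) (itinerary_distr r B M T \<beta>)"
        by (rule d_star_nonneg)
      then show ?case using model[OF elim] unfolding real_norm_def by linarith
    qed
  qed
  also have "(\<lambda>n. 2 * real r * f n) \<in> O(f)" by simp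
  also have "f \<in> O(\<lambda>n. 1 / ln (real n))"
  proof -
    have "1 \<le> card B" using B_nonempty assms(3) by (simp add: Suc_le_eq card_gt_0_iff)
    then show ?thesis
      unfolding f_def using assms(1) by (intro pattern_count_negligible assms(6)) simp_all
  qed
  finally show ?thesis using model by (intro exI[of _ y] exI[of _ \<sigma>]) simp
qed

end
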